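(* Let $\mathbf d\in\mathcal D$. For the Poisson equation $-\mathbf B^{(\mathbf d)}\mathbf g^{(\mathbf d)}=\mathbf f^{(\mathbf d)}-\eta^{\mathbf d}\mathbf e$ in the unknown column vector $\mathbf g^{(\mathbf d)}\in\mathbb R^{N+1}$, there exists a special solution $$\mathbf g_{\mathrm{Sp}}^{\mathbf d}=\bigl(0,(-\mathcal B)^{-1}\mathbf H^{(\mathbf d)}\bigr)^T,$$ and its general solution is related to two free constants $\Im$ and $\xi$ such that $$\mathbf g^{(\mathbf d)}=\mathbf g_{\mathrm{Sp}}^{\mathbf d}+\bigl(1,v(d_1)(-\mathcal B)^{-1}\mathbf e_1\bigr)^T\,\Im+\xi\,\mathbf e,\qquad \Im,\xi\in\mathbb R .$$
   Context: Let $N,K$ be integers with $0<K\le N$; let $\lambda,\mu_1,\mu_2>0$; let $R,C_1,C_{2,1},C_{2,2},C_3,C_4$ be nonnegative real constants with $C_{2,1}>C_{2,2}$, and $P\ge0$. A policy is a vector $\mathbf d=(0;d_1,\ldots,d_K;1,\ldots,1)$ indexed by $0,1,\ldots,N$, with $d_0=0$, $d_i\in\{0,1\}$ for $1\le i\le K$, $d_i=1$ for $K+1\le i\le N$; $\mathcal D$ is the set of all policies. Put $v(d_i)=\mu_1+d_i\mu_2$. $\mathbf B^{(\mathbf d)}$ is the $(N+1)\times(N+1)$ infinitesimal generator of the birth-death process on $\{0,\ldots,N\}$ with birth rate $\lambda$ from $i$ to $i+1$ ($0\le i\le N-1$) and death rate $v(d_i)$ from $i$ to $i-1$ ($1\le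 i\le N$); $\pi^{(\mathbf d)}$ is its unique stationary probability (row) vector. The reward vector $\mathbf f^{(\mathbf d)}$ is the column vector with entries, $0\le i\le N$, $$f^{(\mathbf d)}(i)=R(\mu_1 1_{\{i>0\}}+\mu_2 d_i)-C_1 i-C_{2,1}\mu_1 1_{\{i=0\}}-C_{2,2}\mu_2(1-d_i)-C_3\lambda 1_{\{i<N\}}-C_4\lambda 1_{\{i=N\}}-P\mu_2 d_i 1_{\{1\le i\le K\}},$$ and $\eta^{\mathbf d}=\pi^{(\mathbf d)}\mathbf f^{(\mathbf d)}$. $\mathbf e$ is the column vector of ones. $\mathcal B$ is the $N\times N$ matrix obtained from $\mathbf B^{(\mathbf d)}$ by deleting the first row and first column (it is invertible); $\mathbf H^{(\mathbf d)}$ is the column vector of size $N$ obtained from $\mathbf f^{(\mathbf d)}-\eta^{\mathbf d}\mathbf e$ by deleting its first entry; $\mathbf e_1\in\mathbb R^N$ is the column vector with first entry $1$ and all others $0$. For a scalar $a$ and a column vector $\mathbf b\in\mathbb R^N$, $(a,\mathbf b)^T$ denotes the column vector in $\mathbb R^{N+1}$ with first entry $a$ followed by the entries of $\mathbf b$. *)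

theory Defs
  imports Complex_Main
    "Jordan_Normal_Form.Gauss_Jordan_Elimination"
    "Jordan_Normal_Form.Determinant"
begin

text \<open>
  Vectors over the state space \<open>{0, \<dots>, N}\<close> are elements of \<open>carrier_vec (N + 1)\<close>, indexed from 0,
  so that indices coincide with states.  Vectors and matrices over \<open>{1, \<dots>, N}\<close> have dimension \<open>N\<close>;
  there, index \<open>i\<close> stands for state \<open>i + 1\<close>.
\<close>

definition policies :: "nat \<Rightarrow> nat \<Rightarrow> real vec set" where
  "policies N K = {d \<in> carrier_vec (N + 1).
     d $ 0 = 0 \<and> (\<forall>i\<in>{1..K}. d $ i \<in> {0, 1}) \<and> (\<forall>i\<in>{K+1..N}. d $ i = 1)}"

definition service_rate :: "real \<Rightarrow> real \<Rightarrow> real \<Rightarrow> real" where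
  "service_rate mu1 mu2 x = mu1 + x * mu2"

definition birth_death_generator :: "nat \<Rightarrow> real \<Rightarrow> (nat \<Rightarrow> real) \<Rightarrow> real mat" where
  "birth_death_generator N lam death = mat (N + 1) (N + 1) (\<lambda>(i, j).
     if j = i + 1 then lam
     else if i = j + 1 then death i
     else if i = j then - (lam * of_bool (i < N) + death i * of_bool (0 < i))
     else 0)"

definition policy_generator :: "nat \<Rightarrow> real \<Rightarrow> real \<Rightarrow> real \<Rightarrow> real vec \<Rightarrow> real mat" where
  "policy_generator N lam mu1 mu2 d =
     birth_death_generator N lam (\<lambda>i. service_rate mu1 mu2 (d $ i))"

text \<open>The equation \<open>\<pi> Q = 0\<close> for a row vector \<open>\<pi>\<close> is written in transposed form.\<close>

definition is_stationary :: "real mat \<Rightarrow> real vec \<Rightarrow> bool" where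
  "is_stationary Q p \<longleftrightarrow> p \<in> carrier_vec (dim_row Q) \<and> (\<forall>i<dim_row Q. 0 \<le> p $ i) \<and>
     (\<Sum>i<dim_row Q. p $ i) = 1 \<and> Q\<^sup>T *\<^sub>v p = 0\<^sub>v (dim_col Q)"

definition stationary_vec :: "real mat \<Rightarrow> real vec" where
  "stationary_vec Q = (THE p. is_stationary Q p)"

definition reward_vec :: "nat \<Rightarrow> nat \<Rightarrow> real \<Rightarrow> real \<Rightarrow> real \<Rightarrow>
    real \<Rightarrow> real \<Rightarrow> real \<Rightarrow> real \<Rightarrow> real \<Rightarrow> real \<Rightarrow> real \<Rightarrow> real vec \<Rightarrow> real vec" where
  "reward_vec N K lam mu1 mu2 R C1 C21 C22 C3 C4 P d = vec (N + 1) (\<lambda>i.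
     R * (mu1 * of_bool (i > 0) + mu2 * d $ i)
     - C1 * real i
     - C21 * mu1 * of_bool (i = 0)
     - C22 * mu2 * (1 - d $ i)
     - C3 * lam * of_bool (i < N)
     - C4 * lam * of_bool (i = N)
     - P * mu2 * d $ i * of_bool (1 \<le> i \<and> i \<le> K))"

definition average_reward :: "real mat \<Rightarrow> real vec \<Rightarrow> real" where
  "average_reward Q f = stationary_vec Q \<bullet> f"

definition ones_vec :: "nat \<Rightarrow> real vec" where
  "ones_vec n = vec n (\<lambda>_. 1)"

text \<open>Only meaningful for invertible \<open>A\<close>, since \<open>mat_inverse\<close> is option-valued.\<close>

definition inv_mat :: "real mat \<Rightarrow> real mat" where
  "inv_mat A = the (mat_inverse A)"

definition reduced_generator :: "nat \<Rightarrow> real \<Rightarrow> real \<Rightarrow> real \<Rightarrow> real vec \<Rightarrow> real mat" where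
  "reduced_generator N lam mu1 mu2 d = mat_delete (policy_generator N lam mu1 mu2 d) 0 0"

text \<open>
  The description operator in \<open>stationary_vec\<close> and the inverse in \<open>inv_mat\<close> are well defined
  for the generators considered here.
\<close>

lemma dim_birth_death_generator [simp]:
  "dim_row (birth_death_generator N lam v) = N + 1"
  "dim_col (birth_death_generator N lam v) = N + 1"
  by (simp_all add: birth_death_generator_def)

lemma birth_death_generator_mult_index:
  assumes x: "x \<in> carrier_vec (N + 1)" and i: "i \<le> N"
  shows "(birth_death_generator N lam v *\<^sub>v x) $ i =
    lam * (if i < N then x $ (i + 1) - x $ i else 0)
    + v i * (if 0 < i then x $ (i - 1) - x $ i else 0)"
proof -
  have "(birth_death_generator N lam v *\<^sub>v x) $ i =
     (\<Sum>j<N+1. (birth_death_generator N lam v) $$ (i, j) * x $ j)"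
    using x i by (simp add: scalar_prod_def atLeast0LessThan)
  also have "\<dots> = (\<Sum>j<N+1. (if j = i + 1 then lam * x $ j else 0)
      + ((if j = i - 1 then (if 0 < i then v i * x $ j else 0) else 0)
      + (if j = i then - (lam * of_bool (i < N) + v i * of_bool (0 < i)) * x $ j else 0)))"
    using i by (intro sum.cong) (auto simp: birth_death_generator_def)
  also have "\<dots> = lam * (if i < N then x $ (i + 1) - x $ i else 0)
    + v i * (if 0 < i then x $ (i - 1) - x $ i else 0)"
  proof -
    have "(i + 1 < N + 1) = (i < N)" "i - 1 < N + 1" "i < N + 1" using i by auto
    then show ?thesis
      using i by (simp only: sum.distrib sum.delta finite_lessThan lessThan_iff)
        (cases "i = N"; cases "i = 0"; simp add: ring_distribs)
  qed
  finally show ?thesis .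
qed

lemma birth_death_generator_transpose_mult_index:
  assumes p: "p \<in> carrier_vec (N + 1)" and j: "j \<le> N"
  shows "((birth_death_generator N lam v)\<^sup>T *\<^sub>v p) $ j =
    (if 0 < j then lam * p $ (j - 1) - v j * p $ j else 0)
    - (if j < N then lam * p $ j - v (j + 1) * p $ (j + 1) else 0)"
proof -
  have "((birth_death_generator N lam v)\<^sup>T *\<^sub>v p) $ j =
     (\<Sum>i<N+1. (birth_death_generator N lam v) $$ (i, j) * p $ i)"
    using p j by (simp add: scalar_prod_def atLeast0LessThan)
  also have "\<dots> = (\<Sum>i<N+1. (if i = j + 1 then v i * p $ i else 0)
      + ((if i = j - 1 then (if 0 < j then lam * p $ i else 0) else 0)
      + (if i = j then - (lam * of_bool (i < N) + v i * of_bool (0 < i)) * p $ i else 0)))"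
    using j by (intro sum.cong) (auto simp: birth_death_generator_def)
  also have "\<dots> = (if 0 < j then lam * p $ (j - 1) - v j * p $ j else 0)
    - (if j < N then lam * p $ j - v (j + 1) * p $ (j + 1) else 0)"
  proof -
    have "(j + 1 < N + 1) = (j < N)" "j - 1 < N + 1" "j < N + 1" using j by auto
    then show ?thesis
      using j by (simp only: sum.distrib sum.delta finite_lessThan lessThan_iff)
        (cases "j = N"; cases "j = 0"; simp add: ring_distribs)
  qed
  finally show ?thesis .
qed

lemma stationary_detailed_balance:
  assumes p: "p \<in> carrier_vec (N + 1)"
  shows "(birth_death_generator N lam v)\<^sup>T *\<^sub>v p = 0\<^sub>v (N + 1) \<longleftrightarrow>
    (\<forall>j<N. lam * p $ j = v (j + 1) * p $ (j + 1))" (is "?Q\<^sup>T *\<^sub>v p = _ \<longleftrightarrow> ?R")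
proof
  assume z: "?Q\<^sup>T *\<^sub>v p = 0\<^sub>v (N + 1)"
  have "lam * p $ j = v (j + 1) * p $ (j + 1)" if "j < N" for j
    using that
  proof (induction j)
    case 0
    have "(?Q\<^sup>T *\<^sub>v p) $ 0 = 0" using z by simp
    with 0 show ?case using birth_death_generator_transpose_mult_index[OF p, of 0 lam v] by simp
  next
    case (Suc j)
    have "(?Q\<^sup>T *\<^sub>v p) $ Suc j = 0" using z Suc.prems by simp
    with Suc show ?case
      using birth_death_generator_transpose_mult_index[OF p, of "Suc j" lam v] by simp
  qed
  then show ?R by simp
next
  assume r: ?R
  show "?Q\<^sup>T *\<^sub>v p = 0\<^sub>v (N + 1)"
  proof (rule eq_vecI)
    fix j assume "j < dim_vec (0\<^sub>v (N + 1) :: real vec)"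
    then have j: "j \<le> N" by simp
    have "0 < j \<Longrightarrow> lam * p $ (j - 1) = v j * p $ j" using r j
      by (metis Suc_diff_1 Suc_eq_plus1 Suc_le_lessD)
    then show "(?Q\<^sup>T *\<^sub>v p) $ j = (0\<^sub>v (N + 1) :: real vec) $ j"
      using j r birth_death_generator_transpose_mult_index[OF p j, of lam v] by auto
  qed simp
qed

lemma ex1_stationary_birth_death:
  assumes lam: "lam > 0" and v: "\<And>i. 1 \<le> i \<Longrightarrow> i \<le> N \<Longrightarrow> v i > 0"
  shows "\<exists>!p. is_stationary (birth_death_generator N lam v) p"
proof -
  define w where "w i = (\<Prod>k=1..i. lam / v k)" for i
  have wpos: "w i > 0" if "i \<le> N" for i
    unfolding w_def using lam v that by (intro prod_pos) auto
  define S where "S = (\<Sum>i<N+1. w i)"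
  have Spos: "S > 0" unfolding S_def using wpos by (intro sum_pos) auto
  define q where "q = vec (N + 1) (\<lambda>i. w i / S)"
  have q: "q \<in> carrier_vec (N + 1)" by (simp add: q_def)
  have w_step: "w (Suc j) = w j * lam / v (Suc j)" for j by (simp add: w_def)
  have "is_stationary (birth_death_generator N lam v) q"
  proof -
    have "lam * q $ j = v (j + 1) * q $ (j + 1)" if "j < N" for j
      using that v[of "Suc j"] by (simp add: q_def w_step)
    then have "(birth_death_generator N lam v)\<^sup>T *\<^sub>v q = 0\<^sub>v (N + 1)"
      using stationary_detailed_balance[OF q] by blast
    moreover have "(\<Sum>i<N+1. q $ i) = 1"
    proof -
      have "(\<Sum>i<N+1. q $ i) = (\<Sum>i<N+1. w i / S)" by (intro sum.cong) (auto simp: q_def)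
      also have "\<dots> = 1" using Spos by (simp only: sum_divide_distrib[symmetric] S_def[symmetric]) simp
      finally show ?thesis .
    qed
    moreover have "\<forall>i<N+1. 0 \<le> q $ i"
      using wpos Spos by (auto simp: q_def less_imp_le)
    ultimately show ?thesis using q by (simp add: is_stationary_def)
  qed
  moreover have "p = q" if st: "is_stationary (birth_death_generator N lam v) p" for p
  proof -
    have p: "p \<in> carrier_vec (N + 1)" and s: "(\<Sum>i<N+1. p $ i) = 1"
      and "(birth_death_generator N lam v)\<^sup>T *\<^sub>v p = 0\<^sub>v (N + 1)"
      using st by (simp_all add: is_stationary_def)
    then have db: "\<forall>j<N. lam * p $ j = v (j + 1) * p $ (j + 1)"
      using stationary_detailed_balance by blast
    have pw: "p $ i = p $ 0 * w i" if "i \<le> N" for i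
      using that
    proof (induction i)
      case 0 show ?case by (simp add: w_def)
    next
      case (Suc i)
      then have "lam * p $ i = v (Suc i) * p $ Suc i" using db[rule_format, of i] by simp
      moreover have "v (Suc i) > 0" using v Suc.prems by simp
      ultimately have "p $ Suc i = p $ i * lam / v (Suc i)"
        by (simp add: eq_divide_eq mult.commute)
      moreover have "p $ i = p $ 0 * w i" using Suc by simp
      ultimately show ?case by (simp add: w_step)
    qed
    have "(\<Sum>i<N+1. p $ i) = (\<Sum>i<N+1. p $ 0 * w i)" by (intro sum.cong) (auto intro: pw)
    then have "p $ 0 * S = 1" using s by (simp only: S_def sum_distrib_left)
    then have "p $ 0 = 1 / S" using Spos by (simp add: field_simps)
    then have "p $ i = q $ i" if "i \<le> N" for i
      using pw[OF that] that by (simp add: q_def)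
    then show "p = q" using p q by (intro eq_vecI) auto
  qed
  ultimately show ?thesis by blast
qed

lemma reduced_birth_death_invertible:
  assumes N: "N \<ge> 1" and v: "\<And>i. 1 \<le> i \<Longrightarrow> i \<le> N \<Longrightarrow> v i > 0"
  shows "mat_inverse (- mat_delete (birth_death_generator N lam v) 0 0) \<noteq> None"
proof -
  let ?Q = "birth_death_generator N lam v"
  let ?A = "- mat_delete ?Q 0 0"
  have A: "?A \<in> carrier_mat N N"
    by (simp add: mat_delete_def)
  have "det ?A \<noteq> 0"
  proof
    assume "det ?A = 0"
    then obtain x where x: "x \<in> carrier_vec N" "x \<noteq> 0\<^sub>v N" "?A *\<^sub>v x = 0\<^sub>v N"
      using det_0_iff_vec_prod_zero_field[OF A] by blast
    define y where "y = vCons 0 x"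
    have y: "y \<in> carrier_vec (N + 1)" using x by (simp add: y_def)
    have row: "(?Q *\<^sub>v y) $ Suc i = 0" if i: "i < N" for i
    proof -
      have "0 = (?A *\<^sub>v x) $ i" using i by (simp only: x(3)) simp
      also have "\<dots> = (\<Sum>j<N. - ?Q $$ (Suc i, Suc j) * x $ j)"
        using x(1) i by (simp add: scalar_prod_def atLeast0LessThan mat_delete_def sum_negf)
      also have "\<dots> = - (\<Sum>j<Suc N. ?Q $$ (Suc i, j) * y $ j)"
        by (subst sum.lessThan_Suc_shift) (simp add: y_def sum_negf)
      also have "\<dots> = - (?Q *\<^sub>v y) $ Suc i"
        using y i by (simp add: scalar_prod_def atLeast0LessThan)
      finally show ?thesis by simp
    qed
    have step: "y $ Suc i = y $ i" if "i < N" for i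
      using that
    proof (induction "N - i" arbitrary: i)
      case 0 then show ?case by simp
    next
      case (Suc n)
      have "Suc i < N \<Longrightarrow> y $ Suc (Suc i) = y $ Suc i" using Suc by simp
      moreover have "v (Suc i) > 0" using v Suc.prems by simp
      ultimately show ?case
        using row[OF Suc.prems] birth_death_generator_mult_index[OF y, of "Suc i" lam v] Suc.prems
        by (auto split: if_splits)
    qed
    have y0: "y $ i = 0" if "i \<le> N" for i
      using that by (induction i) (simp_all add: step, simp add: y_def)
    have "x $ i = 0" if "i < N" for i
      using y0[of "Suc i"] that by (simp add: y_def)
    then have "x = 0\<^sub>v N" using x(1) by (intro eq_vecI) auto
    with x(2) show False by simp
  qed
  then have "?A \<in> Units (ring_mat TYPE(real) N undefined)"
    by (rule det_non_zero_imp_unit[OF A])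
  then show ?thesis using mat_inverse(1)[OF A] by metis
qed

lemma policy_service_rate_pos:
  assumes "d \<in> policies N K" "mu1 > 0" "mu2 > 0" "1 \<le> i" "i \<le> N"
  shows "service_rate mu1 mu2 (d $ i) > 0"
proof -
  have "d $ i \<in> {0, 1}"
    using assms(1,4,5) by (cases "i \<le> K") (auto simp: policies_def)
  then show ?thesis using assms(2,3) by (auto simp: service_rate_def)
qed

lemma ex1_stationary_policy_generator:
  assumes "d \<in> policies N K" "lam > 0" "mu1 > 0" "mu2 > 0"
  shows "\<exists>!p. is_stationary (policy_generator N lam mu1 mu2 d) p"
  unfolding policy_generator_def
  using assms policy_service_rate_pos by (intro ex1_stationary_birth_death) auto

lemma reduced_generator_invertible:
  assumes "d \<in> policies N K" "N \<ge> 1" "mu1 > 0" "mu2 > 0"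
  shows "mat_inverse (- reduced_generator N lam mu1 mu2 d) \<noteq> None"
  unfolding reduced_generator_def policy_generator_def
  using assms policy_service_rate_pos by (intro reduced_birth_death_invertible) auto

end

theory Submission
  imports Defs
begin

text \<open>
  The rows of a generator sum to zero, so \<open>(-\<B>) \<e> = v(d\<^sub>1) \<e>\<^sub>1\<close> and the vector
  multiplied by the first free constant is itself the vector of ones: the two constants span
  only the one-dimensional kernel of the generator.  Subtracting a multiple of the ones
  vector makes the first entry of a solution vanish, and rows \<open>1, \<dots>, N\<close> then determine the
  remaining entries through \<open>(-\<B>)\<^sup>-\<^sup>1\<close>.  Row 0 of the equation is implied by the other rows,
  because \<open>\<pi>\<close> annihilates both sides and \<open>\<pi>\<^sub>0 \<noteq> 0\<close>.
\<close>

lemma ones_vec_carrier [simp]: "ones_vec n \<in> carrier_vec n"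
  and ones_vec_index [simp]: "i < n \<Longrightarrow> ones_vec n $ i = 1"
  and dim_ones_vec [simp]: "dim_vec (ones_vec n) = n"
  by (simp_all add: ones_vec_def)

lemma ones_vec_Suc: "ones_vec (Suc n) = vCons 1 (ones_vec n)"
proof (rule eq_vecI)
  fix i assume "i < dim_vec (vCons 1 (ones_vec n))"
  then show "ones_vec (Suc n) $ i = vCons 1 (ones_vec n) $ i"
    by (cases i) simp_all
qed simp

lemma vec_last_index:
  assumes "r \<in> carrier_vec (Suc n)" "i < n"
  shows "vec_last r n $ i = r $ Suc i"
  using assms by (simp add: vec_last_def)

text \<open>Splitting off column 0 of the row sum isolates the contribution of the first entry
  \<open>a\<close>. With \<open>a = 0\<close>, the rows below the first of \<open>- Q\<close> act on
  the tail exactly as the reduced matrix does.\<close>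

lemma uminus_mult_vCons_index_Suc:
  fixes Q :: "real mat"
  assumes "Q \<in> carrier_mat (Suc n) (Suc n)" "x \<in> carrier_vec n" "i < n"
  shows "((- Q) *\<^sub>v vCons a x) $ Suc i =
    ((- mat_delete Q 0 0) *\<^sub>v x) $ i - a * Q $$ (Suc i, 0)"
proof -
  have "((- Q) *\<^sub>v vCons a x) $ Suc i = (\<Sum>j<Suc n. - Q $$ (Suc i, j) * vCons a x $ j)"
    using assms by (simp add: scalar_prod_def atLeast0LessThan sum_negf)
  also have "\<dots> = - Q $$ (Suc i, 0) * a + (\<Sum>j<n. - Q $$ (Suc i, Suc j) * x $ j)"
    by (subst sum.lessThan_Suc_shift) simp
  also have "(\<Sum>j<n. - Q $$ (Suc i, Suc j) * x $ j) = ((- mat_delete Q 0 0) *\<^sub>v x) $ i"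
    using assms by (simp add: scalar_prod_def atLeast0LessThan mat_delete_def sum_negf)
  finally show ?thesis by simp
qed

text \<open>Each row of \<open>Q\<close> sums to zero, so deleting column 0 leaves a row sum equal
  to minus the deleted entry.\<close>

lemma uminus_mat_delete_mult_ones:
  fixes Q :: "real mat"
  assumes Q: "Q \<in> carrier_mat (Suc n) (Suc n)"
    and ones: "Q *\<^sub>v ones_vec (Suc n) = 0\<^sub>v (Suc n)"
  shows "(- mat_delete Q 0 0) *\<^sub>v ones_vec n = vec n (\<lambda>i. Q $$ (Suc i, 0))"
proof (rule eq_vecI)
  fix i assume "i < dim_vec (vec n (\<lambda>i. Q $$ (Suc i, 0)))"
  then have i: "i < n" by simp
  have "((- Q) *\<^sub>v vCons 1 (ones_vec n)) $ Suc i = - (Q *\<^sub>v ones_vec (Suc n)) $ Suc i"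
    using Q i by (simp add: ones_vec_Suc)
  also have "\<dots> = 0" using ones i by simp
  finally show "((- mat_delete Q 0 0) *\<^sub>v ones_vec n) $ i = vec n (\<lambda>i. Q $$ (Suc i, 0)) $ i"
    using uminus_mult_vCons_index_Suc[OF Q ones_vec_carrier i, of 1] i by simp
qed (use Q in \<open>simp add: mat_delete_def\<close>)

text \<open>Once the tails agree, the two scalar products differ only by \<open>p $ 0\<close> times
  the difference of the first entries. This recovers row 0 of the Poisson equation from the other
  rows.\<close>

lemma eq_vec_if_scalar_prod_eq:
  fixes p x y :: "real vec"
  assumes "p \<in> carrier_vec (Suc n)" "x \<in> carrier_vec (Suc n)" "y \<in> carrier_vec (Suc n)"
    and "p $ 0 \<noteq> 0" "p \<bullet> x = p \<bullet> y" and tail: "\<And>i. i < n \<Longrightarrow> x $ Suc i = y $ Suc i"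
  shows "x = y"
proof -
  have split: "p \<bullet> z = p $ 0 * z $ 0 + (\<Sum>i<n. p $ Suc i * z $ Suc i)"
    if "z \<in> carrier_vec (Suc n)" for z
    using that by (simp add: scalar_prod_def atLeast0LessThan sum.lessThan_Suc_shift del: sum.lessThan_Suc)
  have "(\<Sum>i<n. p $ Suc i * x $ Suc i) = (\<Sum>i<n. p $ Suc i * y $ Suc i)"
    using tail by simp
  then have "x $ 0 = y $ 0" using assms(4,5) split[OF assms(2)] split[OF assms(3)] by simp
  then have "x $ i = y $ i" if "i < Suc n" for i
    using tail that by (cases i) auto
  then show ?thesis using assms(2,3) by (intro eq_vecI) auto
qed

text \<open>Pure linear algebra, free of birth-death structure: the invertible reduced block
  confines the kernel of \<open>Q\<close> to the multiples of the ones vector, and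
  \<open>p \<bullet> r = 0\<close> is the solvability condition.\<close>

lemma poisson_equation_solutions:
  fixes Q M :: "real mat" and p r :: "real vec"
  assumes Q: "Q \<in> carrier_mat (Suc n) (Suc n)"
    and ones: "Q *\<^sub>v ones_vec (Suc n) = 0\<^sub>v (Suc n)"
    and M: "M \<in> carrier_mat n n"
    and inv: "M * (- mat_delete Q 0 0) = 1\<^sub>m n" "(- mat_delete Q 0 0) * M = 1\<^sub>m n"
    and p: "p \<in> carrier_vec (Suc n)" "Q\<^sup>T *\<^sub>v p = 0\<^sub>v (Suc n)" "p $ 0 \<noteq> 0"
    and r: "r \<in> carrier_vec (Suc n)" "p \<bullet> r = 0"
  shows "{g \<in> carrier_vec (Suc n). (- Q) *\<^sub>v g = r} =
    {vCons 0 (M *\<^sub>v vec_last r n) + c \<cdot>\<^sub>v ones_vec (Suc n) | c. True}"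
proof -
  let ?A = "- mat_delete Q 0 0" and ?H = "vec_last r n" and ?e = "ones_vec (Suc n)"
  let ?s = "vCons 0 (M *\<^sub>v ?H)"
  have A: "?A \<in> carrier_mat n n" using Q by (simp add: mat_delete_def)
  have H: "?H \<in> carrier_vec n" by (simp add: vec_last_def)
  have MH: "M *\<^sub>v ?H \<in> carrier_vec n" using M H by simp
  have s: "?s \<in> carrier_vec (Suc n)" using MH by simp
  have nQ: "- Q \<in> carrier_mat (Suc n) (Suc n)" using Q by simp
  have shift: "(- Q) *\<^sub>v (g + c \<cdot>\<^sub>v ?e) = (- Q) *\<^sub>v g" if g: "g \<in> carrier_vec (Suc n)" for g c
  proof -
    have "(- Q) *\<^sub>v ?e = 0\<^sub>v (Suc n)"
      using ones Q by (intro eq_vecI) (auto simp: vec_eq_iff)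
    moreover have "c \<cdot>\<^sub>v 0\<^sub>v (Suc n) = (0\<^sub>v (Suc n) :: real vec)"
      by (rule eq_vecI) simp_all
    ultimately have "(- Q) *\<^sub>v (c \<cdot>\<^sub>v ?e) = 0\<^sub>v (Suc n)"
      using mult_mat_vec[OF nQ ones_vec_carrier, of c] by simp
    then show ?thesis
      using mult_add_distrib_mat_vec[OF nQ g, of "c \<cdot>\<^sub>v ?e"] mult_mat_vec_carrier[OF nQ g] by simp
  qed
  \<comment> \<open>Rows 1 to \<open>n\<close> hold by the choice of \<open>?s\<close>; row 0 is
    obtained separately from \<open>p\<close>.\<close>
  have "?A *\<^sub>v (M *\<^sub>v ?H) = ?H"
    using assoc_mult_mat_vec[OF A M H] inv(2) H by simp
  then have tail: "((- Q) *\<^sub>v ?s) $ Suc i = r $ Suc i" if "i < n" for i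
    using uminus_mult_vCons_index_Suc[OF Q MH that, of 0] vec_last_index[OF r(1) that] by simp
  \<comment> \<open>Moving \<open>Q\<close> to the other side of the scalar product turns it into
    its transpose, which annihilates \<open>p\<close>.\<close>
  have "p \<bullet> ((- Q) *\<^sub>v ?s) = 0"
  proof -
    have "p \<bullet> (Q *\<^sub>v ?s) = (Q\<^sup>T *\<^sub>v p) \<bullet> ?s"
      using transpose_vec_mult_scalar[OF Q s p(1)] by simp
    moreover have "(- Q) *\<^sub>v ?s = - (Q *\<^sub>v ?s)"
      using Q M by (intro uminus_mult_mat_vec) simp
    ultimately show ?thesis using p(1,2) s Q M by simp
  qed
  then have sol: "(- Q) *\<^sub>v ?s = r"
    using eq_vec_if_scalar_prod_eq[OF p(1) mult_mat_vec_carrier[OF nQ s] r(1) p(3) _ tail] r(2)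
    by simp
  have "\<exists>c. g = ?s + c \<cdot>\<^sub>v ?e" if g: "g \<in> carrier_vec (Suc n)" "(- Q) *\<^sub>v g = r" for g
  proof -
    \<comment> \<open>Normalising \<open>g\<close> to vanish in state 0 makes \<open>g $ 0\<close>
      the free constant and leaves a tail fixed by the reduced system.\<close>
    define x where "x = vec n (\<lambda>i. g $ Suc i - g $ 0)"
    have x: "x \<in> carrier_vec n" by (simp add: x_def)
    have gx: "g = vCons 0 x + (g $ 0) \<cdot>\<^sub>v ?e"
    proof (rule eq_vecI)
      fix i assume "i < dim_vec (vCons 0 x + (g $ 0) \<cdot>\<^sub>v ?e)"
      then show "g $ i = (vCons 0 x + (g $ 0) \<cdot>\<^sub>v ?e) $ i"
        by (cases i) (simp_all add: x_def)
    qed (use g in simp)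
    have "(- Q) *\<^sub>v vCons 0 x = r"
      using shift[of "vCons 0 x" "g $ 0"] g(2) x unfolding gx[symmetric] by simp
    then have "(?A *\<^sub>v x) $ i = ?H $ i" if "i < n" for i
      using uminus_mult_vCons_index_Suc[OF Q x that, of 0] vec_last_index[OF r(1) that] by simp
    then have "?A *\<^sub>v x = ?H" using A H by (intro eq_vecI) auto
    then have "M *\<^sub>v ?H = x" using assoc_mult_mat_vec[OF M A x] inv(1) x by simp
    with gx show ?thesis by metis
  qed
  moreover have "?s + c \<cdot>\<^sub>v ?e \<in> carrier_vec (Suc n)" "(- Q) *\<^sub>v (?s + c \<cdot>\<^sub>v ?e) = r" for c
    using s shift[OF s] sol by simp_all
  ultimately show ?thesis by blast
qed

lemma birth_death_generator_mult_ones: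
  "birth_death_generator N lam v *\<^sub>v ones_vec (N + 1) = 0\<^sub>v (N + 1)"
proof (rule eq_vecI)
  fix i assume "i < dim_vec (0\<^sub>v (N + 1) :: real vec)"
  then have "i \<le> N" by simp
  then show "(birth_death_generator N lam v *\<^sub>v ones_vec (N + 1)) $ i = (0\<^sub>v (N + 1) :: real vec) $ i"
    by (subst birth_death_generator_mult_index) (auto simp: ones_vec_def)
qed simp

text \<open>By detailed balance a zero in state 0 would propagate upwards through every state,
  contradicting total mass 1.\<close>

lemma stationary_birth_death_first_nonzero:
  assumes st: "is_stationary (birth_death_generator N lam v) p"
    and v: "\<And>i. 1 \<le> i \<Longrightarrow> i \<le> N \<Longrightarrow> v i > 0"
  shows "p $ 0 \<noteq> 0"
proof
  assume p0: "p $ 0 = 0"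
  have p: "p \<in> carrier_vec (N + 1)" using st by (simp add: is_stationary_def)
  then have db: "\<forall>j<N. lam * p $ j = v (j + 1) * p $ (j + 1)"
    using st stationary_detailed_balance by (simp add: is_stationary_def)
  have "p $ i = 0" if "i \<le> N" for i
    using that
  proof (induction i)
    case (Suc i)
    then show ?case using db[rule_format, of i] v[of "Suc i"] by auto
  qed (simp add: p0)
  then have "(\<Sum>i<N+1. p $ i) = 0" by (intro sum.neutral) auto
  then show False using st by (simp add: is_stationary_def)
qed

theorem theorem1:
  fixes N K :: nat
    and lam mu1 mu2 R C1 C21 C22 C3 C4 P :: real
    and d :: "real vec"
  assumes "0 < K" and "K \<le> N"
    and "lam > 0" and "mu1 > 0" and "mu2 > 0"
    and "R \<ge> 0" and "C1 \<ge> 0" and "C21 \<ge> 0" and "C22 \<ge> 0" and "C3 \<ge> 0" and "C4 \<ge> 0"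
    and "C21 > C22" and "P \<ge> 0"
    and "d \<in> policies N K"
  shows "let
      B = policy_generator N lam mu1 mu2 d;
      f = reward_vec N K lam mu1 mu2 R C1 C21 C22 C3 C4 P d;
      eta = average_reward B f;
      rhs = f - eta \<cdot>\<^sub>v ones_vec (N + 1);
      solutions = {g \<in> carrier_vec (N + 1). (- B) *\<^sub>v g = rhs};
      neg_red_inv = inv_mat (- reduced_generator N lam mu1 mu2 d);
      H = vec_last rhs N;
      g_sp = vCons 0 (neg_red_inv *\<^sub>v H);
      h = vCons 1 (service_rate mu1 mu2 (d $ 1) \<cdot>\<^sub>v (neg_red_inv *\<^sub>v unit_vec N 0))
    in g_sp \<in> solutions \<and>
       solutions = {g_sp + a \<cdot>\<^sub>v h + xi \<cdot>\<^sub>v ones_vec (N + 1) | a xi :: real. True}"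
proof -
  note d = \<open>d \<in> policies N K\<close>
  have N: "N \<ge> 1" using assms(1,2) by simp
  define B where "B = policy_generator N lam mu1 mu2 d"
  define f where "f = reward_vec N K lam mu1 mu2 R C1 C21 C22 C3 C4 P d"
  define eta where "eta = average_reward B f"
  define rhs where "rhs = f - eta \<cdot>\<^sub>v ones_vec (N + 1)"
  define M where "M = inv_mat (- reduced_generator N lam mu1 mu2 d)"
  define p where "p = stationary_vec B"
  let ?s = "vCons 0 (M *\<^sub>v vec_last rhs N)" and ?e = "ones_vec (N + 1)"
  let ?h = "vCons 1 (service_rate mu1 mu2 (d $ 1) \<cdot>\<^sub>v (M *\<^sub>v unit_vec N 0))"
  have red: "reduced_generator N lam mu1 mu2 d = mat_delete B 0 0"
    by (simp add: reduced_generator_def B_def)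
  have B: "B \<in> carrier_mat (Suc N) (Suc N)"
    unfolding B_def policy_generator_def by (intro carrier_matI) simp_all
  have A: "- mat_delete B 0 0 \<in> carrier_mat N N" using B by (simp add: mat_delete_def)
  have Be: "B *\<^sub>v ones_vec (Suc N) = 0\<^sub>v (Suc N)"
    using birth_death_generator_mult_ones by (simp add: B_def policy_generator_def)
  have "mat_inverse (- mat_delete B 0 0) = Some M"
    using reduced_generator_invertible[OF d N assms(4,5), of lam]
    by (auto simp: M_def inv_mat_def red)
  then have M: "M \<in> carrier_mat N N"
    and inv: "M * (- mat_delete B 0 0) = 1\<^sub>m N" "(- mat_delete B 0 0) * M = 1\<^sub>m N"
    using mat_inverse(2)[OF A] by auto
  have st: "is_stationary B p"
    unfolding p_def stationary_vec_def B_def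
    by (rule theI'[OF ex1_stationary_policy_generator[OF d assms(3-5)]])
  then have p: "p \<in> carrier_vec (Suc N)" "B\<^sup>T *\<^sub>v p = 0\<^sub>v (Suc N)" and sum: "(\<Sum>i<Suc N. p $ i) = 1"
    using B by (auto simp: is_stationary_def)
  have p0: "p $ 0 \<noteq> 0"
    using stationary_birth_death_first_nonzero st policy_service_rate_pos[OF d assms(4,5)]
    unfolding B_def policy_generator_def by blast
  have f: "f \<in> carrier_vec (Suc N)" by (simp add: f_def reward_vec_def)
  then have r: "rhs \<in> carrier_vec (Suc N)" by (simp add: rhs_def)
  have "p \<bullet> ones_vec (Suc N) = 1"
    using sum by (simp add: scalar_prod_def atLeast0LessThan)
  \<comment> \<open>Since \<open>eta\<close> is \<open>p \<bullet> f\<close> and \<open>p\<close>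
    has total mass 1, centring by \<open>eta\<close> yields exactly the solvability
    condition.\<close>
  then have "p \<bullet> rhs = 0"
    using scalar_prod_minus_distrib[OF p(1) f, of "eta \<cdot>\<^sub>v ones_vec (Suc N)"] p(1)
    by (simp add: rhs_def eta_def average_reward_def p_def)
  note sol = poisson_equation_solutions[OF B Be M inv p p0 r this]
  \<comment> \<open>Only state 1, which has index 0 in the reduced system, can jump to state 0, and
    it does so at rate v(d_1).\<close>
  have "(- mat_delete B 0 0) *\<^sub>v ones_vec N = service_rate mu1 mu2 (d $ 1) \<cdot>\<^sub>v unit_vec N 0"
    unfolding uminus_mat_delete_mult_ones[OF B Be]
    by (intro eq_vecI) (auto simp: B_def policy_generator_def birth_death_generator_def unit_vec_def)
  then have "service_rate mu1 mu2 (d $ 1) \<cdot>\<^sub>v (M *\<^sub>v unit_vec N 0) =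
      M *\<^sub>v ((- mat_delete B 0 0) *\<^sub>v ones_vec N)"
    using mult_mat_vec[OF M unit_vec_carrier] by simp
  also have "\<dots> = ones_vec N"
    using assoc_mult_mat_vec[OF M A ones_vec_carrier] inv(1) by simp
  finally have h: "?h = ?e" by (simp add: ones_vec_Suc)
  have s: "?s \<in> carrier_vec (N + 1)" using M by simp
  \<comment> \<open>The constant 0 exhibits the special solution as a member of the solution
    set.\<close>
  have "?s + 0 \<cdot>\<^sub>v ?e = ?s" using s M by (intro eq_vecI) auto
  from this[symmetric] have "?s \<in> {?s + c \<cdot>\<^sub>v ?e | c. True}" by blast
  moreover have "{?s + a \<cdot>\<^sub>v ?h + xi \<cdot>\<^sub>v ?e | a xi. True} = {?s + c \<cdot>\<^sub>v ?e | c. True}"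
  proof -
    \<comment> \<open>With \<open>?h = ?e\<close> only the sum of the two constants matters;
      conversely, any \<open>c\<close> arises from \<open>a = 0\<close> and
      \<open>xi = c\<close>.\<close>
    have "?s + a \<cdot>\<^sub>v ?e + xi \<cdot>\<^sub>v ?e = ?s + (a + xi) \<cdot>\<^sub>v ?e" for a xi
      using s by (simp add: add_smult_distrib_vec assoc_add_vec[of _ "N + 1"])
    then have "(\<exists>a xi. z = ?s + a \<cdot>\<^sub>v ?e + xi \<cdot>\<^sub>v ?e) \<longleftrightarrow> (\<exists>c. z = ?s + c \<cdot>\<^sub>v ?e)" for z
      by (metis add_0)
    then show ?thesis unfolding h by simp
  qed
  ultimately show ?thesis
    using sol unfolding Let_def B_def[symmetric] f_def[symmetric] eta_def[symmetric]
      rhs_def[symmetric] M_def[symmetric] by simp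
qed

end
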